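(* Let $\mathfrak{X}=\{X_1,\dots,X_n\}$ be a frame of linearly independent smooth vector fields on $\mathbb{R}^n$, with induced Riemannian metric $g$ and distance $d$, and let $\mathfrak{Z}=\mathfrak{X}\otimes\mathfrak{X}$ be the doubled frame on $\mathbb{R}^n\times\mathbb{R}^n$. Given a compact set $K\subset\mathbb{R}^n$, there is a constant $C(K,\mathfrak{X})$ depending on $K$ and the frame $\mathfrak{X}$ such that $$0\le\langle ((D^2_{\mathfrak{Z}}d)^* )^2\cdot D_{\mathfrak{Z}}d,D_{\mathfrak{Z}}d\rangle_g\le C(K,\mathfrak{X})$$ at every $(x,y)\in K\times K$ with $x\neq y$ in a neighborhood of which $(x,y)\mapsto d(x,y)$ is smooth.
   Context: The Riemannian metric $g$ on $\mathbb{R}^n$ is the one for which $\{X_1(x),\dots,X_n(x)\}$ is orthonormal at every $x$; $d$ is its Riemannian distance. $X_i^x$ and $X_i^y$ denote the vector field $X_i$ acting on the $x$ variable and on the $y$ variable, respectively. For a smooth function $u(x,y)$, the $\mathfrak{Z}$-gradient $D_{\mathfrak{Z}}u$ is the $2n\times1$ column vector $(X_1^xu,\dots,X_n^xu,X_1^yu,\dots,X_n^yu)^t$. $D^2_{\mathfrak{Z}}u$ is the $2n\times 2n$ matrix with $n\times n$ blocks $$D^2_{\mathfrak{Z}}u=\begin{pmatrix}(X_i^xX_j^xu)_{ij}&(X_i^xX_j^yu)_{ij}\\ (X_i^yX_j^xu)_{ij}&(X_i^yX_j^yu)_{ij}\end{pmatrix},$$ and $(D^2_{\mathfrak{Z}}u)^*=\frac12\big(D^2_{\mathfrak{Z}}u+(D^2_{\mathfrak{Z}}u)^t\big)$.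 On such $2n$-vectors of frame components, $\langle v,w\rangle_g=\sum_{k=1}^{2n}v_kw_k$. *)

theory Defs
  imports "HOL-Analysis.Analysis"
begin

(* Meant for open S. In finite dimension, a map is C^(k+1) iff it is differentiable and each of its
   directional derivatives is C^k. *)
primrec Ck_on :: "nat \<Rightarrow> 'a::euclidean_space set \<Rightarrow> ('a \<Rightarrow> 'b::real_normed_vector) \<Rightarrow> bool" where
  "Ck_on 0 S f \<longleftrightarrow> continuous_on S f"
| "Ck_on (Suc k) S f \<longleftrightarrow> (\<forall>x\<in>S. f differentiable (at x)) \<and>
     (\<forall>v. Ck_on k S (\<lambda>x. frechet_derivative f (at x) v))"

definition smooth_on :: "'a::euclidean_space set \<Rightarrow> ('a \<Rightarrow> 'b::real_normed_vector) \<Rightarrow> bool" where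
  "smooth_on S f \<longleftrightarrow> (\<forall>k. Ck_on k S f)"

(* Injectivity is needed because "independent" is about the set of values, not the family. *)
definition smooth_frame :: "('n::finite \<Rightarrow> real^'n \<Rightarrow> real^'n) \<Rightarrow> bool" where
  "smooth_frame X \<longleftrightarrow> (\<forall>i. smooth_on UNIV (X i)) \<and>
     (\<forall>x. inj (\<lambda>i. X i x) \<and> independent (range (\<lambda>i. X i x)))"

definition frame_coeffs :: "('n::finite \<Rightarrow> real^'n \<Rightarrow> real^'n) \<Rightarrow> real^'n \<Rightarrow> real^'n \<Rightarrow> real^'n" where
  "frame_coeffs X x v = (THE c. v = (\<Sum>i\<in>UNIV. c $ i *\<^sub>R X i x))"

(* The inner product on the tangent space at x that makes the frame orthonormal; see
   frame_metric_orthonormal and frame_metric_inner_product below. *)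
definition frame_metric ::
  "('n::finite \<Rightarrow> real^'n \<Rightarrow> real^'n) \<Rightarrow> real^'n \<Rightarrow> real^'n \<Rightarrow> real^'n \<Rightarrow> real" where
  "frame_metric X x v w = frame_coeffs X x v \<bullet> frame_coeffs X x w"

definition speed :: "('n::finite \<Rightarrow> real^'n \<Rightarrow> real^'n) \<Rightarrow> (real \<Rightarrow> real^'n) \<Rightarrow> real \<Rightarrow> real" where
  "speed X \<gamma> t = (let v = vector_derivative \<gamma> (at t) in sqrt (frame_metric X (\<gamma> t) v v))"

definition curve_length :: "('n::finite \<Rightarrow> real^'n \<Rightarrow> real^'n) \<Rightarrow> (real \<Rightarrow> real^'n) \<Rightarrow> real" where
  "curve_length X \<gamma> = integral {0..1} (speed X \<gamma>)"

(* A valid_path is piecewise C^1, but its derivative may be unbounded near the finitely many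
   exceptional parameters. Integrability of the speed excludes curves of infinite length, on which
   "integral" would return 0. *)
definition riemannian_dist ::
  "('n::finite \<Rightarrow> real^'n \<Rightarrow> real^'n) \<Rightarrow> real^'n \<Rightarrow> real^'n \<Rightarrow> real" where
  "riemannian_dist X x y = Inf {curve_length X \<gamma> | \<gamma>.
     valid_path \<gamma> \<and> pathstart \<gamma> = x \<and> pathfinish \<gamma> = y \<and> speed X \<gamma> integrable_on {0..1}}"

definition vf_apply :: "('a::real_normed_vector \<Rightarrow> 'a) \<Rightarrow> ('a \<Rightarrow> real) \<Rightarrow> 'a \<Rightarrow> real" where
  "vf_apply V u p = frechet_derivative u (at p) (V p)"

(* Inl i is the copy of X i acting on the first variable, Inr i the copy acting on the second;
   see vf_apply_doubled_Inl and vf_apply_doubled_Inr below. *)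
definition doubled_frame :: "('n::finite \<Rightarrow> real^'n \<Rightarrow> real^'n) \<Rightarrow>
    'n + 'n \<Rightarrow> (real^'n) \<times> (real^'n) \<Rightarrow> (real^'n) \<times> (real^'n)" where
  "doubled_frame X k p = (case k of Inl i \<Rightarrow> (X i (fst p), 0) | Inr i \<Rightarrow> (0, X i (snd p)))"

definition frame_grad ::
  "('m::finite \<Rightarrow> 'a::real_normed_vector \<Rightarrow> 'a) \<Rightarrow> ('a \<Rightarrow> real) \<Rightarrow> 'a \<Rightarrow> real^'m" where
  "frame_grad Z u p = (\<chi> k. vf_apply (Z k) u p)"

definition frame_hess ::
  "('m::finite \<Rightarrow> 'a::real_normed_vector \<Rightarrow> 'a) \<Rightarrow> ('a \<Rightarrow> real) \<Rightarrow> 'a \<Rightarrow> real^'m^'m" where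
  "frame_hess Z u p = (\<chi> k l. vf_apply (Z k) (vf_apply (Z l) u) p)"

definition sym_part :: "real^'m^'m \<Rightarrow> real^'m^'m" where
  "sym_part A = (1/2) *\<^sub>R (A + transpose A)"

lemma frame_coeffs_unique:
  assumes "smooth_frame X"
  shows "\<exists>!c. v = (\<Sum>i\<in>UNIV. c $ i *\<^sub>R X i x)"
proof -
  let ?L = "\<lambda>c. \<Sum>i\<in>UNIV. c $ i *\<^sub>R X i x"
  have i: "inj (\<lambda>i. X i x)" and ind: "independent (range (\<lambda>i. X i x))"
    using assms by (auto simp: smooth_frame_def)
  have lin: "linear ?L"
    by (auto intro!: linearI simp: scaleR_add_left sum.distrib scaleR_right.sum)
  have "c = 0" if "?L c = 0" for c
  proof -
    let ?u = "\<lambda>b. c $ (inv (\<lambda>i. X i x) b)"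
    have "(\<Sum>b\<in>range (\<lambda>i. X i x). ?u b *\<^sub>R b) = 0"
      using that by (simp add: sum.reindex[OF i] inv_f_f[OF i])
    then have "?u (X j x) = 0" for j
      by (intro independentD[OF ind _ subset_refl]) auto
    then show "c = 0"
      by (simp add: inv_f_f[OF i] vec_eq_iff)
  qed
  then have inj: "inj ?L"
    using linear_injective_0[OF lin] by blast
  then have "surj ?L"
    using linear_injective_imp_surjective[OF lin] by simp
  then obtain c where c: "v = ?L c" by blast
  show ?thesis
  proof (rule ex1I)
    show "v = ?L c" by (rule c)
    show "c' = c" if "v = ?L c'" for c'
      by (rule injD[OF inj]) (rule trans[OF that[symmetric] c])
  qed
qed

lemma frame_coeffs_eqI:
  assumes "smooth_frame X" "v = (\<Sum>i\<in>UNIV. c $ i *\<^sub>R X i x)"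
  shows "frame_coeffs X x v = c"
  unfolding frame_coeffs_def using frame_coeffs_unique[OF assms(1)] assms(2)
  by (rule the1_equality)

lemma frame_coeffs_sum:
  assumes "smooth_frame X"
  shows "(\<Sum>i\<in>UNIV. frame_coeffs X x v $ i *\<^sub>R X i x) = v"
  using theI'[OF frame_coeffs_unique[OF assms]] by (simp add: frame_coeffs_def)

lemma linear_frame_coeffs:
  assumes "smooth_frame X"
  shows "linear (frame_coeffs X x)"
proof (rule linearI)
  fix v w r
  show "frame_coeffs X x (v + w) = frame_coeffs X x v + frame_coeffs X x w"
    by (rule frame_coeffs_eqI[OF assms])
       (simp only: vector_add_component scaleR_add_left sum.distrib frame_coeffs_sum[OF assms])
  show "frame_coeffs X x (r *\<^sub>R v) = r *\<^sub>R frame_coeffs X x v"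
    by (rule frame_coeffs_eqI[OF assms])
       (simp only: vector_scaleR_component real_scaleR_def scaleR_scaleR[symmetric]
         scaleR_right.sum[symmetric] frame_coeffs_sum[OF assms])
qed

lemma frame_metric_orthonormal:
  assumes "smooth_frame X"
  shows "frame_metric X x (X i x) (X j x) = (if i = j then 1 else 0)"
proof -
  have "frame_coeffs X x (X k x) = axis k 1" for k
    by (rule frame_coeffs_eqI[OF assms]) (simp add: axis_def if_distrib[of "\<lambda>r. r *\<^sub>R _"] cong: if_cong)
  then show ?thesis
    by (simp add: frame_metric_def inner_axis_axis)
qed

lemma frame_metric_inner_product:
  assumes "smooth_frame X"
  shows "linear (frame_metric X x v)" "frame_metric X x v w = frame_metric X x w v"
    "v \<noteq> 0 \<Longrightarrow> frame_metric X x v v > 0"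
proof -
  show "linear (frame_metric X x v)"
    using linear_frame_coeffs[OF assms, of x]
    by (auto intro!: linearI simp: frame_metric_def linear_add linear_scale inner_add_right)
  show "frame_metric X x v w = frame_metric X x w v"
    by (simp add: frame_metric_def inner_commute)
  show "frame_metric X x v v > 0" if "v \<noteq> 0"
    using that frame_coeffs_sum[OF assms, of x v] by (auto simp: frame_metric_def)
qed

lemma vf_apply_doubled_Inl:
  assumes "u differentiable (at (x, y))"
  shows "vf_apply (doubled_frame X (Inl i)) u (x, y) = vf_apply (X i) (\<lambda>x'. u (x', y)) x"
proof -
  have "(u has_derivative frechet_derivative u (at (x, y))) (at (x, y))"
    using assms frechet_derivative_works by blast
  moreover have "((\<lambda>x'. (x', y)) has_derivative (\<lambda>h. (h, 0))) (at x)"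
    by (auto intro!: derivative_eq_intros)
  ultimately have "((\<lambda>x'. u (x', y)) has_derivative
      (\<lambda>h. frechet_derivative u (at (x, y)) (h, 0))) (at x)"
    using diff_chain_at[of "\<lambda>x'. (x', y)" "\<lambda>h. (h, 0)" x u] by (simp add: o_def)
  then show ?thesis
    by (simp add: vf_apply_def doubled_frame_def frechet_derivative_at[symmetric])
qed

lemma vf_apply_doubled_Inr:
  assumes "u differentiable (at (x, y))"
  shows "vf_apply (doubled_frame X (Inr i)) u (x, y) = vf_apply (X i) (\<lambda>y'. u (x, y')) y"
proof -
  have "(u has_derivative frechet_derivative u (at (x, y))) (at (x, y))"
    using assms frechet_derivative_works by blast
  moreover have "((\<lambda>y'. (x, y')) has_derivative (\<lambda>h. (0, h))) (at y)"
    by (auto intro!: derivative_eq_intros)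
  ultimately have "((\<lambda>y'. u (x, y')) has_derivative
      (\<lambda>h. frechet_derivative u (at (x, y)) (0, h))) (at y)"
    using diff_chain_at[of "\<lambda>y'. (x, y')" "\<lambda>h. (0, h)" y u] by (simp add: o_def)
  then show ?thesis
    by (simp add: vf_apply_def doubled_frame_def frechet_derivative_at[symmetric])
qed

end

(* Away from the diagonal d satisfies the eikonal equation in each variable wherever it is
   differentiable. No completeness or minimising geodesic is needed: a nearly minimising curve from x
   to y is cut where it first leaves a small sphere around x, and the initial piece shows that d
   decreases at almost unit rate towards the exit point. Hence the squared length of D_Z d is locally
   constantly 2, and differentiating it along the frame gives D^2_Z d . D_Z d = 0. The transposed
   Hessian differs from the Hessian by the values of d on the brackets [Z_k, Z_l], so (D^2_Z d)^* . D_Z d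
   is a sum of bracket terms only; these involve first derivatives of d and are bounded on K x K by
   continuity of the frame. The quadratic form of the statement is the squared norm of this vector. *)

theory Submission
  imports Defs
begin

section \<open>Calculus of smooth functions\<close>

lemma smooth_on_differentiable: "smooth_on S f \<Longrightarrow> x \<in> S \<Longrightarrow> f differentiable (at x)"
  unfolding smooth_on_def by (metis Ck_on.simps(2))

lemma smooth_on_frechet: "smooth_on S f \<Longrightarrow> smooth_on S (\<lambda>x. frechet_derivative f (at x) v)"
  unfolding smooth_on_def by (metis Ck_on.simps(2))

lemma smooth_on_continuous_on: "smooth_on S f \<Longrightarrow> continuous_on S f"
  unfolding smooth_on_def by (metis Ck_on.simps(1))

lemma Ck_on_subset: "Ck_on k S f \<Longrightarrow> T \<subseteq> S \<Longrightarrow> Ck_on k T f"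
  by (induction k arbitrary: f) (auto intro: continuous_on_subset)

lemma smooth_on_subset: "smooth_on S f \<Longrightarrow> T \<subseteq> S \<Longrightarrow> smooth_on T f"
  unfolding smooth_on_def using Ck_on_subset by blast

lemma linear_frechet_derivative: "f differentiable (at x) \<Longrightarrow> linear (frechet_derivative f (at x))"
  using frechet_derivative_works has_derivative_linear by blast

lemma linear_sum_Basis:
  fixes f :: "'a::euclidean_space \<Rightarrow> 'b::real_vector"
  assumes "linear f"
  shows "f v = (\<Sum>b\<in>Basis. (v \<bullet> b) *\<^sub>R f b)"
  by (subst (1) euclidean_representation[of v, symmetric])
     (simp only: linear_sum[OF assms] linear_scale[OF assms])

section \<open>Symmetry of second derivatives\<close>

lemma second_difference_mvt:
  fixes f :: "'a::euclidean_space \<Rightarrow> real"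
  assumes h: "0 < h"
    and df: "\<And>s t. 0 \<le> s \<Longrightarrow> s \<le> h \<Longrightarrow> 0 \<le> t \<Longrightarrow> t \<le> h \<Longrightarrow> f differentiable (at (p + s *\<^sub>R u + t *\<^sub>R v))"
    and dg: "\<And>s t. 0 \<le> s \<Longrightarrow> s \<le> h \<Longrightarrow> 0 \<le> t \<Longrightarrow> t \<le> h \<Longrightarrow>
      (\<lambda>q. frechet_derivative f (at q) u) differentiable (at (p + s *\<^sub>R u + t *\<^sub>R v))"
  shows "\<exists>s t. 0 < s \<and> s < h \<and> 0 < t \<and> t < h \<and>
    f (p + h *\<^sub>R u + h *\<^sub>R v) - f (p + h *\<^sub>R u) - f (p + h *\<^sub>R v) + f p =
    h * h * frechet_derivative (\<lambda>q. frechet_derivative f (at q) u) (at (p + s *\<^sub>R u + t *\<^sub>R v)) v"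
proof -
  let ?g = "\<lambda>q. frechet_derivative f (at q) u"
  \<comment> \<open>The second difference of \<open>f\<close> is the increment of
    \<open>?\<phi>\<close> from 0 to \<open>h\<close>. The mean value theorem is applied once in
    \<open>s\<close> and once in \<open>t\<close>, and yields the mixed derivative at an interior
    point of the parallelogram.\<close>
  let ?\<phi> = "\<lambda>s. f (p + s *\<^sub>R u + h *\<^sub>R v) - f (p + s *\<^sub>R u)"
  have *: "((\<lambda>s. f (p + s *\<^sub>R u + t *\<^sub>R v)) has_real_derivative ?g (p + s *\<^sub>R u + t *\<^sub>R v)) (at s)"
    if "0 \<le> s" "s \<le> h" "0 \<le> t" "t \<le> h" for s t
  proof -
    have "(f has_derivative frechet_derivative f (at (p + s *\<^sub>R u + t *\<^sub>R v))) (at (p + s *\<^sub>R u + t *\<^sub>R v))"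
      using df[OF that] frechet_derivative_works by blast
    moreover have "((\<lambda>s. p + s *\<^sub>R u + t *\<^sub>R v) has_derivative (\<lambda>k. k *\<^sub>R u)) (at s)"
      by (auto intro!: derivative_eq_intros)
    ultimately have "((\<lambda>s. f (p + s *\<^sub>R u + t *\<^sub>R v)) has_derivative
      (\<lambda>k. frechet_derivative f (at (p + s *\<^sub>R u + t *\<^sub>R v)) (k *\<^sub>R u))) (at s)"
      using diff_chain_at[of "\<lambda>s. p + s *\<^sub>R u + t *\<^sub>R v" "\<lambda>k. k *\<^sub>R u" s f] by (simp add: o_def)
    then show ?thesis
      unfolding has_field_derivative_def
      by (simp add: linear_scale[OF linear_frechet_derivative[OF df[OF that]]] mult_commute_abs)
  qed
  have "(?\<phi> has_real_derivative ?g (p + s *\<^sub>R u + h *\<^sub>R v) - ?g (p + s *\<^sub>R u)) (at s)"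
    if "0 \<le> s" "s \<le> h" for s
    using DERIV_diff[OF *[of s h] *[of s 0]] that h by simp
  from MVT2[OF h this] obtain s where s: "0 < s" "s < h"
    "?\<phi> h - ?\<phi> 0 = h * (?g (p + s *\<^sub>R u + h *\<^sub>R v) - ?g (p + s *\<^sub>R u))"
    by auto
  have "((\<lambda>t. ?g (p + s *\<^sub>R u + t *\<^sub>R v)) has_real_derivative
      frechet_derivative ?g (at (p + s *\<^sub>R u + t *\<^sub>R v)) v) (at t)"
    if "0 \<le> t" "t \<le> h" for t
  proof -
    have d: "?g differentiable (at (p + s *\<^sub>R u + t *\<^sub>R v))"
      using dg that s by simp
    then have "(?g has_derivative frechet_derivative ?g (at (p + s *\<^sub>R u + t *\<^sub>R v))) (at (p + s *\<^sub>R u + t *\<^sub>R v))"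
      using frechet_derivative_works by blast
    moreover have "((\<lambda>t. p + s *\<^sub>R u + t *\<^sub>R v) has_derivative (\<lambda>k. k *\<^sub>R v)) (at t)"
      by (auto intro!: derivative_eq_intros)
    ultimately have "((\<lambda>t. ?g (p + s *\<^sub>R u + t *\<^sub>R v)) has_derivative
      (\<lambda>k. frechet_derivative ?g (at (p + s *\<^sub>R u + t *\<^sub>R v)) (k *\<^sub>R v))) (at t)"
      using diff_chain_at[of "\<lambda>t. p + s *\<^sub>R u + t *\<^sub>R v" "\<lambda>k. k *\<^sub>R v" t ?g] by (simp add: o_def)
    then show ?thesis
      unfolding has_field_derivative_def
      by (simp add: linear_scale[OF linear_frechet_derivative[OF d]] mult_commute_abs)
  qed
  from MVT2[OF h this] obtain t where t: "0 < t" "t < h"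
    "?g (p + s *\<^sub>R u + h *\<^sub>R v) - ?g (p + s *\<^sub>R u) =
      h * frechet_derivative ?g (at (p + s *\<^sub>R u + t *\<^sub>R v)) v"
    by auto
  show ?thesis
    using s t by (intro exI[of _ s] exI[of _ t]) (simp add: algebra_simps)
qed

text \<open>The second difference over a parallelogram at \<open>p\<close> does not change when
  \<open>u\<close> and \<open>v\<close> are exchanged. Hence a value of one mixed derivative near
  \<open>p\<close> equals a value of the other near \<open>p\<close>, and continuity of both at
  \<open>p\<close> forces equality there.\<close>

lemma second_derivative_symmetric:
  fixes f :: "'a::euclidean_space \<Rightarrow> real"
  assumes U: "open U" "p \<in> U" and f: "smooth_on U f"
  shows "frechet_derivative (\<lambda>q. frechet_derivative f (at q) u) (at p) v =
    frechet_derivative (\<lambda>q. frechet_derivative f (at q) v) (at p) u"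
proof -
  let ?G = "\<lambda>u v q. frechet_derivative (\<lambda>q. frechet_derivative f (at q) u) (at q) v"
  have cont: "isCont (?G u v) p" for u v
    using smooth_on_continuous_on[OF smooth_on_frechet[OF smooth_on_frechet[OF f]]] U
    by (simp add: continuous_on_eq_continuous_at)
  have "dist (?G u v p) (?G v u p) \<le> e" if e: "e > 0" for e
  proof -
    obtain r1 where r1: "r1 > 0" "\<And>q. dist q p < r1 \<Longrightarrow> dist (?G u v q) (?G u v p) < e / 2"
      using cont[of u v, unfolded continuous_at_eps_delta, rule_format, OF half_gt_zero[OF e]] by blast
    obtain r2 where r2: "r2 > 0" "\<And>q. dist q p < r2 \<Longrightarrow> dist (?G v u q) (?G v u p) < e / 2"
      using cont[of v u, unfolded continuous_at_eps_delta, rule_format, OF half_gt_zero[OF e]] by blast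
    obtain r3 where r3: "r3 > 0" "ball p r3 \<subseteq> U"
      using U open_contains_ball by blast
    define r where "r = min r1 (min r2 r3)"
    \<comment> \<open>The summand 1 keeps \<open>M\<close> positive when \<open>u\<close> and
      \<open>v\<close> both vanish. With the resulting \<open>h\<close> the whole closed
      parallelogram lies within \<open>r / 2\<close> of \<open>p\<close>.\<close>
    define M where "M = norm u + norm v + 1"
    define h where "h = r / (2 * M)"
    have r: "r > 0" using r1 r2 r3 by (simp add: r_def)
    have N: "0 < M" by (simp add: M_def add_nonneg_pos)
    have h: "h > 0" using r N by (simp add: h_def)
    have near: "dist (p + s *\<^sub>R u + t *\<^sub>R v) p < r" if "0 \<le> s" "s \<le> h" "0 \<le> t" "t \<le> h" for s t
    proof -
      have "dist (p + s *\<^sub>R u + t *\<^sub>R v) p = norm (s *\<^sub>R u + t *\<^sub>R v)"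
        by (simp add: dist_norm add.assoc)
      also have "\<dots> \<le> s * norm u + t * norm v"
        using that by (intro order_trans[OF norm_triangle_ineq]) simp
      also have "\<dots> \<le> h * norm u + h * norm v"
        using that by (intro add_mono mult_right_mono) auto
      also have "\<dots> \<le> h * M" using h by (simp add: M_def algebra_simps)
      also have "\<dots> = r / 2" using N by (simp add: h_def)
      finally show ?thesis using r by simp
    qed
    have inU: "p + s *\<^sub>R u + t *\<^sub>R v \<in> U" if "0 \<le> s" "s \<le> h" "0 \<le> t" "t \<le> h" for s t
      using near[OF that] r3 by (auto simp: r_def dist_commute)
    have inU': "p + t *\<^sub>R v + s *\<^sub>R u \<in> U" if "0 \<le> s" "s \<le> h" "0 \<le> t" "t \<le> h" for s t
      using inU[OF that] by (simp add: algebra_simps)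
    obtain s t where st: "0 < s" "s < h" "0 < t" "t < h"
      "f (p + h *\<^sub>R u + h *\<^sub>R v) - f (p + h *\<^sub>R u) - f (p + h *\<^sub>R v) + f p =
        h * h * ?G u v (p + s *\<^sub>R u + t *\<^sub>R v)"
      using second_difference_mvt[OF h, of f p u v] smooth_on_differentiable[OF f inU]
        smooth_on_differentiable[OF smooth_on_frechet[OF f] inU] by blast
    obtain s' t' where st': "0 < s'" "s' < h" "0 < t'" "t' < h"
      "f (p + h *\<^sub>R v + h *\<^sub>R u) - f (p + h *\<^sub>R v) - f (p + h *\<^sub>R u) + f p =
        h * h * ?G v u (p + s' *\<^sub>R v + t' *\<^sub>R u)"
      using second_difference_mvt[OF h, of f p v u] smooth_on_differentiable[OF f inU']
        smooth_on_differentiable[OF smooth_on_frechet[OF f] inU'] by blast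
    have "h * h * ?G u v (p + s *\<^sub>R u + t *\<^sub>R v) = h * h * ?G v u (p + s' *\<^sub>R v + t' *\<^sub>R u)"
      unfolding st(5)[symmetric] st'(5)[symmetric] by (simp add: algebra_simps)
    then have eq: "?G u v (p + s *\<^sub>R u + t *\<^sub>R v) = ?G v u (p + t' *\<^sub>R u + s' *\<^sub>R v)"
      using h by (simp add: algebra_simps)
    have "dist (?G u v (p + s *\<^sub>R u + t *\<^sub>R v)) (?G u v p) < e / 2"
      using near[of s t] st by (intro r1(2)) (simp add: r_def)
    moreover have "dist (?G v u (p + t' *\<^sub>R u + s' *\<^sub>R v)) (?G v u p) < e / 2"
      using near[of t' s'] st' by (intro r2(2)) (simp add: r_def)
    ultimately show ?thesis
      unfolding eq dist_real_def by linarith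
  qed
  then have "dist (?G u v p) (?G v u p) \<le> 0"
    by (rule field_le_epsilon) simp
  then show ?thesis by simp
qed

section \<open>Hessian along a frame and brackets\<close>

lemma vf_apply_has_derivative:
  fixes u :: "'a::euclidean_space \<Rightarrow> real"
  assumes U: "open U" "p \<in> U" and u: "smooth_on U u" and V: "V differentiable (at p)"
  shows "(vf_apply V u has_derivative
    (\<lambda>h. frechet_derivative (\<lambda>q. frechet_derivative u (at q) (V p)) (at p) h +
      frechet_derivative u (at p) (frechet_derivative V (at p) h))) (at p)"
proof -
  let ?D = "\<lambda>q. frechet_derivative u (at q)"
  have gen: "(vf_apply W u has_derivative
      (\<lambda>h. \<Sum>b\<in>Basis. (W p \<bullet> b) * frechet_derivative (\<lambda>q. ?D q b) (at p) h + (frechet_derivative W (at p) h \<bullet> b) * ?D p b)) (at p)"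
    if W: "W differentiable (at p)" for W
  proof (rule has_derivative_transform_within_open[OF _ U])
    have 1: "((\<lambda>q. ?D q b) has_derivative frechet_derivative (\<lambda>q. ?D q b) (at p)) (at p)" for b
      using smooth_on_differentiable[OF smooth_on_frechet[OF u] U(2)] frechet_derivative_works by blast
    have 2: "(W has_derivative frechet_derivative W (at p)) (at p)"
      using W frechet_derivative_works by blast
    show "((\<lambda>q. \<Sum>b\<in>Basis. (W q \<bullet> b) * ?D q b) has_derivative
        (\<lambda>h. \<Sum>b\<in>Basis. (W p \<bullet> b) * frechet_derivative (\<lambda>q. ?D q b) (at p) h + (frechet_derivative W (at p) h \<bullet> b) * ?D p b)) (at p)"
      by (intro has_derivative_sum has_derivative_mult has_derivative_inner_left 1 2)
    show "(\<Sum>b\<in>Basis. (W q \<bullet> b) * ?D q b) = vf_apply W u q" if "q \<in> U" for q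
      unfolding vf_apply_def
      by (subst linear_sum_Basis[OF linear_frechet_derivative[OF smooth_on_differentiable[OF u that]]]) simp
  qed
  have "(vf_apply (\<lambda>_. V p) u has_derivative
      (\<lambda>h. \<Sum>b\<in>Basis. (V p \<bullet> b) * frechet_derivative (\<lambda>q. ?D q b) (at p) h)) (at p)"
    using gen[of "\<lambda>_. V p"] by (simp add: frechet_derivative_const)
  then have "(\<lambda>h. \<Sum>b\<in>Basis. (V p \<bullet> b) * frechet_derivative (\<lambda>q. ?D q b) (at p) h) =
      frechet_derivative (\<lambda>q. ?D q (V p)) (at p)"
    using frechet_derivative_at by (simp add: vf_apply_def[abs_def])
  moreover have "(\<Sum>b\<in>Basis. (frechet_derivative V (at p) h \<bullet> b) * ?D p b) = ?D p (frechet_derivative V (at p) h)" for h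
    by (subst (2) linear_sum_Basis[OF linear_frechet_derivative[OF smooth_on_differentiable[OF u U(2)]]]) simp
  ultimately show ?thesis
    using gen[OF V] by (simp add: sum.distrib fun_eq_iff)
qed

text \<open>Differentiating the constant \<open>|grad u|\<^sup>2\<close> kills the Hessian applied to the gradient, so
  only the part of the transposed Hessian coming from the brackets of the frame survives.\<close>

lemma sym_hess_grad_eq_brackets:
  fixes u :: "'a::euclidean_space \<Rightarrow> real" and Z :: "'m::finite \<Rightarrow> 'a \<Rightarrow> 'a"
  assumes U: "open U" "p \<in> U" and u: "smooth_on U u"
    and Z: "\<And>k. Z k differentiable (at p)"
    and const: "\<And>q. q \<in> U \<Longrightarrow> (\<Sum>l\<in>UNIV. (vf_apply (Z l) u q)\<^sup>2) = c"
  shows "(sym_part (frame_hess Z u p) *v frame_grad Z u p) $ k =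
    (\<Sum>l\<in>UNIV. (frechet_derivative u (at p) (frechet_derivative (Z k) (at p) (Z l p)) -
      frechet_derivative u (at p) (frechet_derivative (Z l) (at p) (Z k p))) * frame_grad Z u p $ l) / 2"
proof -
  let ?v = "\<lambda>l. vf_apply (Z l) u p"
  let ?H = "\<lambda>k l. vf_apply (Z k) (vf_apply (Z l) u) p"
  let ?B = "\<lambda>k l. frechet_derivative u (at p) (frechet_derivative (Z k) (at p) (Z l p))"
  note der = vf_apply_has_derivative[OF U u Z]
  have H: "?H k l = frechet_derivative (\<lambda>q. frechet_derivative u (at q) (Z l p)) (at p) (Z k p) + ?B l k" for k l
    unfolding vf_apply_def[of "Z k"] frechet_derivative_at[OF der, symmetric] ..
  \<comment> \<open>The second derivative in frozen directions is symmetric, so exchanging the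
    indices leaves only the terms where a field is differentiated. Their difference is the
    derivative of \<open>u\<close> along the bracket of \<open>Z l\<close> and
    \<open>Z k\<close>.\<close>
  have swap: "?H l k = ?H k l + (?B k l - ?B l k)" for k l
    unfolding H second_derivative_symmetric[OF U u, of "Z k p" "Z l p"] by simp
  have "((\<lambda>q. \<Sum>l\<in>UNIV. (vf_apply (Z l) u q)\<^sup>2) has_derivative
      (\<lambda>h. \<Sum>l\<in>UNIV. 2 * (frechet_derivative (vf_apply (Z l) u) (at p) h) * ?v l)) (at p)"
    using frechet_derivative_at[OF der, symmetric] der
    by (auto intro!: derivative_eq_intros simp: mult_ac)
  moreover have "((\<lambda>q. \<Sum>l\<in>UNIV. (vf_apply (Z l) u q)\<^sup>2) has_derivative (\<lambda>h. 0)) (at p)"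
    by (rule has_derivative_transform_within_open[OF has_derivative_const[of c] U]) (simp add: const)
  ultimately have "(\<lambda>h. \<Sum>l\<in>UNIV. 2 * (frechet_derivative (vf_apply (Z l) u) (at p) h) * ?v l) = (\<lambda>h. 0)"
    by (rule has_derivative_unique)
  from fun_cong[OF this, of "Z k p"]
  have "2 * (\<Sum>l\<in>UNIV. frechet_derivative (vf_apply (Z l) u) (at p) (Z k p) * ?v l) = 0"
    by (simp only: sum_distrib_left mult.assoc)
  then have Hv: "(\<Sum>l\<in>UNIV. ?H k l * ?v l) = 0"
    by (simp add: vf_apply_def[of "Z k"])
  have "(sym_part (frame_hess Z u p) *v frame_grad Z u p) $ k =
      (\<Sum>l\<in>UNIV. ((?H k l + ?H l k) / 2) * ?v l)"
    by (simp add: sym_part_def frame_hess_def frame_grad_def matrix_vector_mult_def transpose_def)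
  also have "\<dots> = (\<Sum>l\<in>UNIV. ?H k l * ?v l + (?B k l - ?B l k) * ?v l / 2)"
    unfolding swap[where k=k] by (intro sum.cong) (auto simp: field_simps)
  also have "\<dots> = (\<Sum>l\<in>UNIV. (?B k l - ?B l k) * ?v l) / 2"
    by (simp add: sum.distrib Hv sum_divide_distrib)
  finally show ?thesis
    by (simp add: frame_grad_def)
qed

section \<open>Frame coefficients at varying base points\<close>

lemma sqrt_frame_metric: "sqrt (frame_metric X x v v) = norm (frame_coeffs X x v)"
  by (simp add: frame_metric_def norm_eq_sqrt_inner)

lemma speed_eq: "speed X \<gamma> t = norm (frame_coeffs X (\<gamma> t) (vector_derivative \<gamma> (at t)))"
  by (simp add: speed_def Let_def sqrt_frame_metric)

lemma speed_nonneg: "speed X \<gamma> t \<ge> 0"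
  by (simp add: speed_eq)

lemma smooth_frame_isCont: "smooth_frame X \<Longrightarrow> isCont (X i) x"
  using smooth_on_continuous_on[of UNIV "X i"] by (simp add: smooth_frame_def continuous_on_eq_continuous_at)

text \<open>If \<open>c\<close> are the coefficients of \<open>v\<close> at \<open>p\<close>, then
  the coefficients at \<open>x\<close> differ from \<open>c\<close> by those of the sum of
  \<open>c $ i *\<^sub>R (X i p - X i x)\<close>. Continuity of the frame makes this small relative
  to \<open>norm c\<close>, so \<open>r\<close> can be chosen independently of
  \<open>v\<close>.\<close>

lemma frame_coeffs_near:
  assumes X: "smooth_frame X" and e: "e > 0"
  shows "\<exists>r>0. \<forall>p v. dist p x < r \<longrightarrow>
    norm (frame_coeffs X x v - frame_coeffs X p v) \<le> e * norm (frame_coeffs X p v)"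
proof -
  have lin: "linear (frame_coeffs X x)"
    by (rule linear_frame_coeffs[OF X])
  obtain N where N: "N > 0" "\<And>w. norm (frame_coeffs X x w) \<le> N * norm w"
    using linear_bounded_pos[OF lin] by blast
  let ?s = "\<lambda>p. \<Sum>i\<in>UNIV. norm (X i p - X i x)"
  have "isCont ?s x"
    by (intro continuous_intros smooth_frame_isCont[OF X])
  then obtain r where r: "r > 0" "\<And>p. dist p x < r \<Longrightarrow> dist (?s p) (?s x) < e / N"
    unfolding continuous_at_eps_delta using divide_pos_pos[OF e N(1)] by blast
  have "norm (frame_coeffs X x v - frame_coeffs X p v) \<le> e * norm (frame_coeffs X p v)"
    if p: "dist p x < r" for p v
  proof -
    let ?c = "frame_coeffs X p v"
    have "frame_coeffs X x (\<Sum>i\<in>UNIV. ?c $ i *\<^sub>R X i x) = ?c"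
      by (rule frame_coeffs_eqI[OF X]) simp
    then have "frame_coeffs X x v - ?c = frame_coeffs X x (v - (\<Sum>i\<in>UNIV. ?c $ i *\<^sub>R X i x))"
      by (simp add: linear_diff[OF lin])
    also have "v - (\<Sum>i\<in>UNIV. ?c $ i *\<^sub>R X i x) = (\<Sum>i\<in>UNIV. ?c $ i *\<^sub>R (X i p - X i x))"
      by (subst (1) frame_coeffs_sum[OF X, of p v, symmetric]) (simp add: scaleR_diff_right sum_subtractf)
    also have "norm (frame_coeffs X x \<dots>) \<le> N * norm (\<Sum>i\<in>UNIV. ?c $ i *\<^sub>R (X i p - X i x))"
      by (rule N)
    also have "\<dots> \<le> N * (\<Sum>i\<in>UNIV. norm ?c * norm (X i p - X i x))"
      using N(1) by (intro mult_left_mono sum_norm_le) (auto intro!: mult_right_mono component_le_norm_cart)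
    also have "\<dots> = N * ?s p * norm ?c"
      by (simp add: sum_distrib_left mult_ac)
    also have "\<dots> \<le> e * norm ?c"
    proof (rule mult_right_mono)
      have "\<bar>?s p\<bar> < e / N"
        using r(2)[OF p] by (simp add: dist_real_def)
      then have "?s p \<le> e / N" by simp
      then show "N * ?s p \<le> e" using N(1) by (simp add: field_simps)
    qed simp
    finally show ?thesis .
  qed
  with r(1) show ?thesis by blast
qed

text \<open>Coefficients at the fixed point \<open>x\<close> depend linearly on the vector and so
  converge; \<open>frame_coeffs_near\<close> shows that moving the base point to \<open>P t\<close>
  changes them by an amount that tends to 0.\<close>

lemma tendsto_frame_coeffs:
  assumes X: "smooth_frame X" and P: "(P \<longlongrightarrow> x) F" and V: "(V \<longlongrightarrow> v) F"
  shows "((\<lambda>t. frame_coeffs X (P t) (V t)) \<longlongrightarrow> frame_coeffs X x v) F"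
proof -
  have "bounded_linear (frame_coeffs X x)"
    using linear_frame_coeffs[OF X] by (rule linear_conv_bounded_linear[THEN iffD1])
  from bounded_linear.tendsto[OF this V]
  have lim: "((\<lambda>t. frame_coeffs X x (V t)) \<longlongrightarrow> frame_coeffs X x v) F" .
  have "((\<lambda>t. frame_coeffs X x (V t) - frame_coeffs X (P t) (V t)) \<longlongrightarrow> 0) F"
  proof (rule tendstoI)
    fix e :: real assume "e > 0"
    define M where "M = norm (frame_coeffs X x v) + 1"
    \<comment> \<open>The bound 1/2 lets the relative error be absorbed, so that
      \<open>norm ?b\<close> is at most twice \<open>norm ?a\<close>; the other bound then makes the
      error at most \<open>2 * e / 3\<close>.\<close>
    define d where "d = min (1/2) (e / (3 * M))"
    have M: "M > 0" by (simp add: M_def add_nonneg_pos)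
    have d: "d > 0" using \<open>e > 0\<close> M by (simp add: d_def)
    obtain r where r: "r > 0" "\<And>p v. dist p x < r \<Longrightarrow>
        norm (frame_coeffs X x v - frame_coeffs X p v) \<le> d * norm (frame_coeffs X p v)"
      using frame_coeffs_near[OF X d] by metis
    have "\<forall>\<^sub>F t in F. dist (P t) x < r"
      using P r(1) by (rule tendstoD)
    moreover have "\<forall>\<^sub>F t in F. norm (frame_coeffs X x (V t)) < M"
      by (rule order_tendstoD(2)[OF tendsto_norm[OF lim]]) (simp add: M_def)
    ultimately show "\<forall>\<^sub>F t in F. dist (frame_coeffs X x (V t) - frame_coeffs X (P t) (V t)) 0 < e"
    proof eventually_elim
      case (elim t)
      let ?a = "frame_coeffs X x (V t)" and ?b = "frame_coeffs X (P t) (V t)"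
      have 1: "norm (?a - ?b) \<le> d * norm ?b" by (rule r(2)[OF elim(1)])
      also have "\<dots> \<le> 1/2 * norm ?b" by (rule mult_right_mono) (simp_all only: d_def min.cobounded1 norm_ge_zero)
      finally have "norm ?b \<le> 2 * norm ?a"
        using norm_triangle_ineq2[of ?b ?a] by (simp add: norm_minus_commute)
      then have "d * norm ?b \<le> d * (2 * M)"
        using elim(2) d by (intro mult_left_mono) auto
      also have "\<dots> \<le> e / (3 * M) * (2 * M)"
        using M by (intro mult_right_mono) (simp_all only: d_def min.cobounded2)
      also have "\<dots> < e" using \<open>e > 0\<close> M by simp
      finally show ?case using 1 by simp
    qed
  qed
  from tendsto_diff[OF lim this] show ?thesis by simp
qed

section \<open>Curve lengths and the distance\<close>

definition joined_by_length ::
  "('n::finite \<Rightarrow> real^'n \<Rightarrow> real^'n) \<Rightarrow> real^'n \<Rightarrow> real^'n \<Rightarrow> real \<Rightarrow> bool" where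
  "joined_by_length X x y l \<longleftrightarrow> (\<exists>\<gamma>. valid_path \<gamma> \<and> pathstart \<gamma> = x \<and> pathfinish \<gamma> = y \<and>
     (speed X \<gamma> has_integral l) {0..1})"

text \<open>A length expressed through \<open>has_integral\<close> already contains the
  integrability of the speed, so curves can be joined, reversed and cut without a separate side
  condition.\<close>

lemma riemannian_dist_eq: "riemannian_dist X x y = Inf {l. joined_by_length X x y l}"
  unfolding riemannian_dist_def joined_by_length_def curve_length_def has_integral_iff
  by (intro arg_cong[where f = Inf] Collect_cong) auto

lemma joined_by_length_nonneg: "joined_by_length X x y l \<Longrightarrow> 0 \<le> l"
  unfolding joined_by_length_def by (auto intro: has_integral_nonneg simp: speed_nonneg)

lemma riemannian_dist_le: "joined_by_length X x y l \<Longrightarrow> riemannian_dist X x y \<le> l"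
  unfolding riemannian_dist_eq
  by (rule cInf_lower) (auto intro: bdd_belowI[of _ 0] joined_by_length_nonneg)

lemma valid_path_differentiable:
  assumes "valid_path \<gamma>"
  obtains S where "finite S" "\<And>t. t \<in> {0..1} - S \<Longrightarrow> \<gamma> differentiable (at t)"
  using assms unfolding valid_path_def piecewise_C1_differentiable_on_def C1_differentiable_on_eq by blast

lemma speed_affine:
  assumes X: "smooth_frame X" and d: "\<gamma> differentiable (at (m * t + c))"
    and T: "open T" "t \<in> T" and eq: "\<And>s. s \<in> T \<Longrightarrow> \<sigma> s = \<gamma> (m * s + c)"
  shows "speed X \<sigma> t = \<bar>m\<bar> * speed X \<gamma> (m * t + c)"
proof -
  have "((\<lambda>s. m * s + c) has_vector_derivative m) (at t)"
    by (auto intro!: derivative_eq_intros simp: has_vector_derivative_def)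
  moreover have "(\<gamma> has_vector_derivative vector_derivative \<gamma> (at (m * t + c))) (at (m * t + c))"
    using d vector_derivative_works by blast
  ultimately have 1: "((\<lambda>s. \<gamma> (m * s + c)) has_vector_derivative m *\<^sub>R vector_derivative \<gamma> (at (m * t + c))) (at t)"
    using vector_diff_chain_at[of "\<lambda>s. m * s + c" m t \<gamma>] by (simp add: o_def)
  have "(\<sigma> has_vector_derivative m *\<^sub>R vector_derivative \<gamma> (at (m * t + c))) (at t)"
    by (rule has_vector_derivative_transform_within_open[OF 1 T]) (simp add: eq)
  then have "vector_derivative \<sigma> (at t) = m *\<^sub>R vector_derivative \<gamma> (at (m * t + c))"
    by (rule vector_derivative_at)
  then show ?thesis
    using eq[OF T(2)]
    by (simp add: speed_eq linear_scale[OF linear_frame_coeffs[OF X]])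
qed

text \<open>Length is invariant under affine reparametrisation: the factor
  \<open>\<bar>m\<bar>\<close> in the speed cancels the Jacobian. A negative \<open>m\<close> is
  allowed, so joining, reversing and restricting curves are all instances.\<close>

lemma has_integral_speed_affine:
  assumes X: "smooth_frame X" and \<gamma>: "valid_path \<gamma>" and "(speed X \<gamma> has_integral l) {a..b}"
    and "0 \<le> a" "a \<le> b" "b \<le> 1" and m: "m \<noteq> 0"
    and u: "u \<le> v" "(\<lambda>x. m * x + c) ` {u..v} = {a..b}"
    and eq: "\<And>t. u < t \<Longrightarrow> t < v \<Longrightarrow> \<sigma> t = \<gamma> (m * t + c)"
  shows "(speed X \<sigma> has_integral l) {u..v}"
proof -
  obtain S where S: "finite S" "\<And>t. t \<in> {0..1} - S \<Longrightarrow> \<gamma> differentiable (at t)"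
    using valid_path_differentiable[OF \<gamma>] by blast
  have pre: "(\<lambda>x. (1 / m) *\<^sub>R x + - ((1 / m) *\<^sub>R c)) ` cbox a b = {u..v}"
    unfolding cbox_interval u(2)[symmetric] image_image using m by (simp add: field_simps)
  have "((\<lambda>t. speed X \<gamma> (m *\<^sub>R t + c)) has_integral (1 / \<bar>m\<bar>) * l) {u..v}"
    using has_integral_affinity[of "speed X \<gamma>" l a b m c] assms(3) m unfolding pre by simp
  from has_integral_mult_right[OF this, of "\<bar>m\<bar>"]
  have 1: "((\<lambda>t. \<bar>m\<bar> * speed X \<gamma> (m * t + c)) has_integral l) {u..v}"
    using m by simp
  have "finite ((\<lambda>t. m * t + c) -` S)"
    by (rule finite_vimageI[OF S(1)]) (use m in \<open>auto simp: inj_on_def\<close>)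
  \<comment> \<open>The exceptional parameters are the endpoints, where \<open>\<sigma>\<close> is
    not assumed to agree with the reparametrised curve, and the preimages of the points where
    \<open>\<gamma>\<close> may fail to be differentiable.\<close>
  then have fin: "finite ({u, v} \<union> (\<lambda>t. m * t + c) -` S)"
    by simp
  show ?thesis
  proof (rule has_integral_spike_finite[OF fin _ 1])
    fix t assume t: "t \<in> {u..v} - ({u, v} \<union> (\<lambda>t. m * t + c) -` S)"
    then have "m * t + c \<in> {a..b}"
      using u(2) by blast
    then have "\<gamma> differentiable (at (m * t + c))"
      using t assms by (intro S(2)) auto
    then show "speed X \<sigma> t = \<bar>m\<bar> * speed X \<gamma> (m * t + c)"
      by (rule speed_affine[OF X, where T = "{u<..<v}"]) (use t in \<open>auto intro: eq\<close>)
  qed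
qed

lemma affine_image_interval:
  fixes m :: real
  assumes "m > 0"
  shows "(\<lambda>x. m * x + c) ` {u..v} = {m * u + c..m * v + c}"
  using assms by (auto simp: image_affinity_atLeastAtMost)

lemma joined_by_length_join:
  assumes X: "smooth_frame X" and "joined_by_length X x y l" "joined_by_length X y z l'"
  shows "joined_by_length X x z (l + l')"
proof -
  obtain \<gamma> \<gamma>' where g: "valid_path \<gamma>" "pathstart \<gamma> = x" "pathfinish \<gamma> = y" "(speed X \<gamma> has_integral l) {0..1}"
    and g': "valid_path \<gamma>'" "pathstart \<gamma>' = y" "pathfinish \<gamma>' = z" "(speed X \<gamma>' has_integral l') {0..1}"
    using assms unfolding joined_by_length_def by blast
  have "(speed X (\<gamma> +++ \<gamma>') has_integral l) {0..1/2}"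
    by (rule has_integral_speed_affine[OF X g(1) g(4), where m = 2 and c = 0])
       (auto simp: joinpaths_def affine_image_interval[of 2 0, simplified])
  moreover have "(speed X (\<gamma> +++ \<gamma>') has_integral l') {1/2..1}"
    by (rule has_integral_speed_affine[OF X g'(1) g'(4), where m = 2 and c = "-1"])
       (auto simp: joinpaths_def affine_image_interval[of 2 "-1", simplified])
  ultimately have "(speed X (\<gamma> +++ \<gamma>') has_integral l + l') {0..1}"
    by (intro has_integral_combine[of 0 "1/2" 1]) auto
  then show ?thesis
    unfolding joined_by_length_def using g g'
    by (intro exI[of _ "\<gamma> +++ \<gamma>'"] conjI valid_path_join) simp_all
qed

lemma joined_by_length_reverse:
  assumes X: "smooth_frame X" and "joined_by_length X x y l"
  shows "joined_by_length X y x l"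
proof -
  obtain \<gamma> where g: "valid_path \<gamma>" "pathstart \<gamma> = x" "pathfinish \<gamma> = y" "(speed X \<gamma> has_integral l) {0..1}"
    using assms unfolding joined_by_length_def by blast
  have "(speed X (reversepath \<gamma>) has_integral l) {0..1}"
    by (rule has_integral_speed_affine[OF X g(1) g(4), where m = "-1" and c = 1])
       (auto simp: reversepath_def)
  then show ?thesis
    unfolding joined_by_length_def using g by (intro exI[of _ "reversepath \<gamma>"]) auto
qed

lemma joined_by_length_subpath:
  assumes X: "smooth_frame X" and g: "valid_path \<gamma>" and l: "(speed X \<gamma> has_integral l) {t..1}"
    and t: "0 \<le> t" "t \<le> 1"
  shows "joined_by_length X (\<gamma> t) (pathfinish \<gamma>) l"
\<comment> \<open>For \<open>t = 1\<close> the reparametrisation has slope \<open>1 - t = 0\<close>,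
  which the affine change of variables excludes; a constant path serves instead.\<close>
proof (cases "t = 1")
  case True
  have "(speed X (linepath (\<gamma> t) (\<gamma> t)) has_integral 0) {0..1}"
    using linear_0[OF linear_frame_coeffs[OF X]] by (intro has_integral_is_0) (simp add: speed_eq)
  moreover have "l = 0"
    using has_integral_unique[OF l] has_integral_refl(2)[of "speed X \<gamma>" "1::real"] True by simp
  ultimately show ?thesis
    using True unfolding joined_by_length_def
    by (intro exI[of _ "linepath (\<gamma> t) (\<gamma> t)"]) (auto simp: pathfinish_def)
next
  case False
  have "(speed X (subpath t 1 \<gamma>) has_integral l) {0..1}"
    by (rule has_integral_speed_affine[OF X g l, where m = "1 - t" and c = t])
       (use t False in \<open>auto simp: subpath_def affine_image_interval\<close>)
  then show ?thesis
    unfolding joined_by_length_def using g t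
    by (intro exI[of _ "subpath t 1 \<gamma>"] conjI valid_path_subpath) (auto simp: pathfinish_def pathstart_def subpath_def)
qed

text \<open>Segments have continuous speed. They show that the infimum defining the distance is over
  a nonempty set, and they supply explicit upper bounds for the distance between nearby
  points.\<close>

lemma joined_by_length_linepath:
  assumes X: "smooth_frame X"
  shows "joined_by_length X x y (integral {0..1} (\<lambda>t. norm (frame_coeffs X (linepath x y t) (y - x))))"
    (is "joined_by_length X x y (integral {0..1} ?f)")
proof -
  have "continuous_on {0..1} ?f"
    unfolding continuous_on_def
    by (intro ballI tendsto_norm tendsto_frame_coeffs[OF X] tendsto_const)
       (use continuous_on_linepath[of "{0..1}" x y] in \<open>auto simp: continuous_on_def\<close>)
  then have "(?f has_integral integral {0..1} ?f) {0..1}"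
    by (intro integrable_integral integrable_continuous_real)
  then show ?thesis
    unfolding joined_by_length_def speed_eq[abs_def]
    by (intro exI[of _ "linepath x y"]) auto
qed

lemma riemannian_dist_less:
  assumes X: "smooth_frame X" and "riemannian_dist X x y < e"
  obtains l where "joined_by_length X x y l" "l < e"
proof -
  have "{l. joined_by_length X x y l} \<noteq> {}"
    using joined_by_length_linepath[OF X] by blast
  from cInf_lessD[OF this assms(2)[unfolded riemannian_dist_eq]] show ?thesis
    using that by auto
qed

lemma riemannian_dist_sym:
  assumes "smooth_frame X"
  shows "riemannian_dist X x y = riemannian_dist X y x"
  unfolding riemannian_dist_eq using joined_by_length_reverse[OF assms]
  by (intro arg_cong[where f = Inf]) blast

text \<open>The given curve is followed by a nearly minimising one from \<open>y\<close> to
  \<open>z\<close>. The first leg enters through a length because it is applied to a segment whose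
  length is estimated directly.\<close>

lemma riemannian_dist_triangle_length:
  assumes X: "smooth_frame X" and l: "joined_by_length X x y l"
  shows "riemannian_dist X x z \<le> l + riemannian_dist X y z"
proof (rule field_le_epsilon)
  fix e :: real assume "e > 0"
  then obtain l' where "joined_by_length X y z l'" "l' < riemannian_dist X y z + e"
    using riemannian_dist_less[OF X, of y z "riemannian_dist X y z + e"] by auto
  then show "riemannian_dist X x z \<le> l + riemannian_dist X y z + e"
    using riemannian_dist_le[OF joined_by_length_join[OF X l]] by fastforce
qed

section \<open>The eikonal equation in one variable\<close>

lemma derivative_frame_coeffs:
  assumes X: "smooth_frame X" and D: "linear D"
  shows "D v = frame_coeffs X x v \<bullet> (\<chi> i. D (X i x))"
proof -
  have "D v = D (\<Sum>i\<in>UNIV. frame_coeffs X x v $ i *\<^sub>R X i x)"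
    by (simp add: frame_coeffs_sum[OF X])
  then show ?thesis
    by (simp add: linear_sum[OF D] linear_scale[OF D] inner_vec_def)
qed

lemma frame_coeffs_comparable:
  assumes X: "smooth_frame X" and e: "e > 0"
  obtains r where "r > 0"
    "\<And>p v. dist p x < r \<Longrightarrow> norm (frame_coeffs X x v) \<le> (1 + e) * norm (frame_coeffs X p v)"
    "\<And>p v. dist p x < r \<Longrightarrow> (1 - e) * norm (frame_coeffs X p v) \<le> norm (frame_coeffs X x v)"
proof -
  obtain r where r: "r > 0" "\<And>p v. dist p x < r \<Longrightarrow>
      norm (frame_coeffs X x v - frame_coeffs X p v) \<le> e * norm (frame_coeffs X p v)"
    using frame_coeffs_near[OF X e, of x] by blast
  show ?thesis
  proof (rule that[OF r(1)])
    fix p v assume p: "dist p x < r"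
    show "norm (frame_coeffs X x v) \<le> (1 + e) * norm (frame_coeffs X p v)"
      using r(2)[OF p, of v] norm_triangle_ineq2[of "frame_coeffs X x v" "frame_coeffs X p v"]
      by (simp add: algebra_simps)
    show "(1 - e) * norm (frame_coeffs X p v) \<le> norm (frame_coeffs X x v)"
      using r(2)[OF p, of v] norm_triangle_ineq3[of "frame_coeffs X x v" "frame_coeffs X p v"]
      by (simp add: algebra_simps)
  qed
qed

text \<open>By the triangle inequality along the segment from \<open>x + s *\<^sub>R w\<close> to
  \<open>x\<close>, the difference quotient is at most the length of that segment divided by
  \<open>s\<close>. For small \<open>s\<close> this is at most the frame norm of \<open>w\<close>
  over \<open>1 - e\<close>; then \<open>e\<close> tends to 0.\<close>

lemma dist_derivative_le:
  assumes X: "smooth_frame X"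
    and D: "((\<lambda>x'. riemannian_dist X x' y) has_derivative D) (at x)"
  shows "D w \<le> norm (frame_coeffs X x w)"
proof -
  let ?d = "\<lambda>x'. riemannian_dist X x' y"
  let ?n = "norm (frame_coeffs X x w)"
  have "(1 - e) * D w \<le> ?n" if e: "0 < e" "e < 1" for e
  proof -
    obtain r where r: "r > 0"
      "\<And>p v. dist p x < r \<Longrightarrow> (1 - e) * norm (frame_coeffs X p v) \<le> norm (frame_coeffs X x v)"
      using frame_coeffs_comparable[OF X e(1), of x] by metis
    have "D (k *\<^sub>R w) = k * D w" for k
      using linear_scale[OF has_derivative_linear[OF D]] by simp
    moreover have "((\<lambda>s. x + s *\<^sub>R w) has_derivative (\<lambda>k. k *\<^sub>R w)) (at 0)"
      by (auto intro!: derivative_eq_intros)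
    ultimately have "((\<lambda>s. ?d (x + s *\<^sub>R w)) has_derivative (\<lambda>k. k * D w)) (at 0)"
      using diff_chain_at[of "\<lambda>s. x + s *\<^sub>R w" "\<lambda>k. k *\<^sub>R w" 0 ?d D] D by (simp add: o_def)
    then have "((\<lambda>s. ?d (x + s *\<^sub>R w)) has_real_derivative D w) (at 0)"
      by (simp add: has_field_derivative_def mult_commute_abs)
    then have "((\<lambda>s. (?d (x + s *\<^sub>R w) - ?d x) / s) \<longlongrightarrow> D w) (at 0)"
      by (simp add: DERIV_def)
    then have lim: "((\<lambda>s. (?d (x + s *\<^sub>R w) - ?d x) / s) \<longlongrightarrow> D w) (at_right 0)"
      by (rule filterlim_mono) (auto simp: at_le)
    have "((\<lambda>s. norm (s *\<^sub>R w)) \<longlongrightarrow> norm (0 *\<^sub>R w)) (at_right 0)"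
      by (intro tendsto_intros)
    then have "\<forall>\<^sub>F s in at_right 0. norm (s *\<^sub>R w) < r"
      using r(1) by (intro order_tendstoD(2)) auto
    moreover have "\<forall>\<^sub>F s in at_right (0::real). s > 0"
      by (simp add: eventually_at_right_less)
    ultimately have "\<forall>\<^sub>F s in at_right 0. (?d (x + s *\<^sub>R w) - ?d x) / s \<le> ?n / (1 - e)"
    proof eventually_elim
      case (elim s)
      let ?x = "x + s *\<^sub>R w"
      let ?f = "\<lambda>t. norm (frame_coeffs X (linepath ?x x t) (x - ?x))"
      have f: "?f t \<le> s * ?n / (1 - e)" if "t \<in> {0..1}" for t
      proof -
        have "linepath ?x x t = x + ((1 - t) * s) *\<^sub>R w"
          by (simp add: linepath_def algebra_simps)
        moreover have "norm (((1 - t) * s) *\<^sub>R w) \<le> norm (s *\<^sub>R w)"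
          using that by (auto simp: abs_mult mult_le_cancel_right1 intro!: mult_right_mono mult_left_le_one_le)
        ultimately have "dist (linepath ?x x t) x < r"
          using elim by (simp add: dist_norm)
        from r(2)[OF this, of "x - ?x"] have "(1 - e) * ?f t \<le> norm (frame_coeffs X x (- (s *\<^sub>R w)))"
          by simp
        also have "\<dots> = s * ?n"
          using elim by (simp add: linear_neg[OF linear_frame_coeffs[OF X]] linear_scale[OF linear_frame_coeffs[OF X]])
        finally show ?thesis
          using e by (simp add: pos_le_divide_eq mult.commute)
      qed
      have "integral {0..1} ?f \<le> s * ?n / (1 - e)"
      proof (cases "?f integrable_on {0..1}")
        case True
        then have "integral {0..1} ?f \<le> integral {0..1} (\<lambda>_::real. s * ?n / (1 - e))"
          by (intro integral_le f) auto
        then show ?thesis by simp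
      next
        \<comment> \<open>Here \<open>integral\<close> takes its default value 0, and the claimed
          bound is nonnegative.\<close>
        case False
        then show ?thesis
          using e elim by (simp add: not_integrable_integral)
      qed
      moreover have "?d ?x \<le> integral {0..1} ?f + ?d x"
        by (rule riemannian_dist_triangle_length[OF X joined_by_length_linepath[OF X]])
      ultimately have "?d ?x - ?d x \<le> s * ?n / (1 - e)" by linarith
      then show ?case
        using elim by (simp add: pos_divide_le_eq mult.commute)
    qed
    then have "D w \<le> ?n / (1 - e)"
      by (intro tendsto_upperbound[OF lim]) auto
    then show ?thesis
      using e by (simp add: pos_le_divide_eq mult.commute)
  qed
  then have "\<forall>\<^sub>F e in at_right (0::real). (1 - e) * D w \<le> ?n"
    by (auto simp: eventually_at_right[of 0 1] intro!: exI[of _ 1])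
  moreover have "((\<lambda>e. (1 - e) * D w) \<longlongrightarrow> (1 - 0) * D w) (at_right (0::real))"
    by (intro tendsto_intros)
  ultimately show ?thesis
    using tendsto_upperbound[of "\<lambda>e. (1 - e) * D w" "D w" "at_right 0" ?n] by simp
qed

text \<open>The times at distance exactly \<open>r\<close> form a nonempty compact set, and
  \<open>t\<close> is its least element. A larger distance at some earlier time would give a still
  earlier hitting time by the intermediate value theorem.\<close>

lemma first_hitting_time:
  fixes \<gamma> :: "real \<Rightarrow> 'a::metric_space"
  assumes g: "continuous_on {0..1} \<gamma>" and r: "0 < r" "r \<le> dist (\<gamma> 1) (\<gamma> 0)"
  obtains t where "0 < t" "t \<le> 1" "dist (\<gamma> t) (\<gamma> 0) = r"
    "\<And>s. 0 \<le> s \<Longrightarrow> s \<le> t \<Longrightarrow> dist (\<gamma> s) (\<gamma> 0) \<le> r"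
proof -
  let ?f = "\<lambda>t. dist (\<gamma> t) (\<gamma> 0)"
  let ?T = "{t \<in> {0..1}. ?f t = r}"
  have f: "continuous_on {0..1} ?f"
    by (intro continuous_intros g)
  have ivt: "\<exists>u\<ge>0. u \<le> s \<and> ?f u = r" if "0 \<le> s" "s \<le> 1" "r \<le> ?f s" for s
    by (rule IVT') (use that r in \<open>auto intro: continuous_on_subset[OF f]\<close>)
  have "compact ?T"
    unfolding compact_eq_bounded_closed
  proof
    show "bounded ?T"
      using bounded_closed_interval[of "0::real" 1] by (rule bounded_subset) auto
    show "closed ?T"
      by (rule continuous_closed_preimage_constant[OF f]) simp
  qed
  moreover have "?T \<noteq> {}"
    using ivt[of 1] r by auto
  ultimately obtain t where t: "t \<in> ?T" "\<And>s. s \<in> ?T \<Longrightarrow> t \<le> s"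
    using compact_attains_inf[of ?T] by blast
  show ?thesis
  proof
    show "0 < t" "t \<le> 1" "?f t = r"
      using t(1) r by (auto simp: less_le)
    show "?f s \<le> r" if st: "0 \<le> s" "s \<le> t" for s
    proof (rule ccontr)
      assume "\<not> ?f s \<le> r"
      then obtain u where "0 \<le> u" "u \<le> s" "?f u = r"
        using ivt[of s] st t(1) by auto
      then have "s = t"
        using t(2)[of u] t(1) st by auto
      then show False
        using t(1) \<open>\<not> ?f s \<le> r\<close> by auto
    qed
  qed
qed

text \<open>In the fixed inner product at \<open>x\<close> a chord is no longer than the curve. The
  velocity is paired with the constant vector \<open>?w\<close>: the fundamental theorem gives the
  square of \<open>norm ?w\<close>, while Cauchy-Schwarz and the comparison of norms bound the
  integrand by a multiple of the speed.\<close>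

lemma length_ge_frame_norm:
  assumes X: "smooth_frame X" and g: "valid_path \<gamma>" and l: "(speed X \<gamma> has_integral l) {0..t}"
    and t: "0 \<le> t" "t \<le> 1" and c: "c \<ge> 0"
    and comp: "\<And>s v. 0 \<le> s \<Longrightarrow> s \<le> t \<Longrightarrow>
      norm (frame_coeffs X x v) \<le> c * norm (frame_coeffs X (\<gamma> s) v)"
  shows "norm (frame_coeffs X x (\<gamma> t - \<gamma> 0)) \<le> c * l"
proof -
  let ?w = "frame_coeffs X x (\<gamma> t - \<gamma> 0)"
  let ?\<phi> = "\<lambda>v. ?w \<bullet> frame_coeffs X x v"
  obtain S where S: "finite S" "\<And>t. t \<in> {0..1} - S \<Longrightarrow> \<gamma> differentiable (at t)"
    using valid_path_differentiable[OF g] by blast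
  have bl: "bounded_linear (frame_coeffs X x)"
    using linear_frame_coeffs[OF X] by (rule linear_conv_bounded_linear[THEN iffD1])
  have \<phi>: "bounded_linear ?\<phi>"
    by (rule bounded_linear_compose[OF bounded_linear_inner_right bl])
  have cont: "continuous_on {0..t} \<gamma>"
    using valid_path_imp_path[OF g] t unfolding path_def by (auto intro: continuous_on_subset)
  have "((\<lambda>s. ?\<phi> (vector_derivative \<gamma> (at s))) has_integral ?\<phi> (\<gamma> t) - ?\<phi> (\<gamma> 0)) {0..t}"
  proof (rule fundamental_theorem_of_calculus_interior_strong[OF S(1) t(1)])
    show "((\<lambda>s. ?\<phi> (\<gamma> s)) has_vector_derivative ?\<phi> (vector_derivative \<gamma> (at s))) (at s)"
      if "s \<in> {0<..<t} - S" for s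
      using S(2)[of s] that t
      by (intro bounded_linear.has_vector_derivative[OF \<phi>]) (auto simp: vector_derivative_works)
    show "continuous_on {0..t} (\<lambda>s. ?\<phi> (\<gamma> s))"
      by (rule bounded_linear.continuous_on[OF \<phi> cont])
  qed
  moreover have "((\<lambda>s. norm ?w * c * speed X \<gamma> s) has_integral norm ?w * c * l) {0..t}"
    by (rule has_integral_mult_right[OF l])
  ultimately have "?\<phi> (\<gamma> t) - ?\<phi> (\<gamma> 0) \<le> norm ?w * c * l"
  proof (rule has_integral_le)
    fix s assume s: "s \<in> {0..t}"
    have "?\<phi> (vector_derivative \<gamma> (at s)) \<le> norm ?w * norm (frame_coeffs X x (vector_derivative \<gamma> (at s)))"
      by (rule norm_cauchy_schwarz)
    also have "\<dots> \<le> norm ?w * (c * speed X \<gamma> s)"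
      unfolding speed_eq using s by (intro mult_left_mono comp) auto
    finally show "?\<phi> (vector_derivative \<gamma> (at s)) \<le> norm ?w * c * speed X \<gamma> s"
      by (simp add: mult.assoc)
  qed
  moreover have "?\<phi> (\<gamma> t) - ?\<phi> (\<gamma> 0) = norm ?w * norm ?w"
    by (simp add: linear_diff[OF linear_frame_coeffs[OF X]] flip: inner_diff_right norm_eq_square power2_eq_square power2_norm_eq_inner)
  ultimately have "norm ?w * norm ?w \<le> norm ?w * (c * l)"
    by (simp add: mult.assoc)
  moreover have "0 \<le> c * l"
    using has_integral_nonneg[OF l] c by (simp add: speed_nonneg)
  ultimately show ?thesis
    by (cases "norm ?w = 0") (auto simp: mult_le_cancel_left)
qed

text \<open>A nearly minimising curve is cut at its first exit point \<open>?z\<close> from a ball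
  around \<open>x\<close>. The first piece has length at least \<open>norm ?w / (1 + e)\<close> and
  the rest bounds the distance from \<open>?z\<close> to \<open>y\<close>, so the distance drops by
  almost \<open>norm ?w\<close>. The linear approximation by \<open>D\<close> and Cauchy-Schwarz
  turn this drop into a lower bound for \<open>norm ?g\<close>.\<close>

lemma dist_gradient_ge_1:
  assumes X: "smooth_frame X" and xy: "x \<noteq> y"
    and D: "((\<lambda>x'. riemannian_dist X x' y) has_derivative D) (at x)"
  shows "1 \<le> norm (\<chi> i. D (X i x))"
proof -
  let ?d = "\<lambda>x'. riemannian_dist X x' y"
  let ?N = "\<Sum>i\<in>UNIV. norm (X i x)"
  let ?g = "\<chi> i. D (X i x)"
  \<comment> \<open>Converts errors proportional to the Euclidean radius \<open>r\<close> into
    multiples of \<open>norm ?w\<close>, so that \<open>norm ?w\<close> can be cancelled at the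
    end.\<close>
  have N: "norm v \<le> ?N * norm (frame_coeffs X x v)" for v
  proof -
    have "norm (\<Sum>i\<in>UNIV. frame_coeffs X x v $ i *\<^sub>R X i x) \<le> (\<Sum>i\<in>UNIV. norm (X i x) * norm (frame_coeffs X x v))"
      by (intro sum_norm_le) (auto simp: mult.commute intro!: mult_left_mono component_le_norm_cart)
    then show ?thesis by (simp add: frame_coeffs_sum[OF X] sum_distrib_right)
  qed
  have "1 / (1 + e) - 2 * e * ?N \<le> norm ?g" if e: "e > 0" for e
  proof -
    obtain r1 where r1: "r1 > 0"
      "\<And>p v. dist p x < r1 \<Longrightarrow> norm (frame_coeffs X x v) \<le> (1 + e) * norm (frame_coeffs X p v)"
      using frame_coeffs_comparable[OF X e(1), of x] by metis
    obtain r2 where r2: "r2 > 0"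
      "\<And>z. norm (z - x) < r2 \<Longrightarrow> norm (?d z - ?d x - D (z - x)) \<le> e * norm (z - x)"
      using D e unfolding has_derivative_at_alt by blast
    \<comment> \<open>The first bound ensures that the curve to \<open>y\<close> reaches the sphere
      of radius \<open>r\<close>; the halves give the strict inequalities required for the frame
      comparison and the linear approximation.\<close>
    define r where "r = min (dist y x) (min (r1 / 2) (r2 / 2))"
    have r: "r > 0" "r \<le> dist y x" "r < r1" "r < r2"
      using xy r1(1) r2(1) by (auto simp: r_def)
    \<comment> \<open>The excess over the distance must be of order \<open>e * r\<close>: only then
      does it stay proportional to \<open>e\<close> after division by
      \<open>norm ?w\<close>.\<close>
    obtain L where "joined_by_length X x y L" and L: "L < ?d x + e * r"
      using riemannian_dist_less[OF X, of x y "?d x + e * r"] r e by auto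
    then obtain \<gamma> where g: "valid_path \<gamma>" "pathstart \<gamma> = x" "pathfinish \<gamma> = y"
        "(speed X \<gamma> has_integral L) {0..1}"
      unfolding joined_by_length_def by blast
    have ends: "\<gamma> 0 = x" "\<gamma> 1 = y"
      using g by (auto simp: pathstart_def pathfinish_def)
    have "continuous_on {0..1} \<gamma>"
      using valid_path_imp_path[OF g(1)] by (simp add: path_def)
    then obtain t where t: "0 < t" "t \<le> 1" "dist (\<gamma> t) x = r"
        "\<And>s. 0 \<le> s \<Longrightarrow> s \<le> t \<Longrightarrow> dist (\<gamma> s) x \<le> r"
      using first_hitting_time[of \<gamma> r] r unfolding ends by metis
    let ?z = "\<gamma> t"
    let ?w = "frame_coeffs X x (?z - x)"
    have int: "speed X \<gamma> integrable_on {0..1}" using g(4) by blast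
    obtain l1 where l1: "(speed X \<gamma> has_integral l1) {0..t}"
      using integrable_on_subinterval[OF int, of 0 t] t by (auto simp: integrable_on_def)
    obtain l2 where l2: "(speed X \<gamma> has_integral l2) {t..1}"
      using integrable_on_subinterval[OF int, of t 1] t by (auto simp: integrable_on_def)
    have "l1 + l2 = L"
      using has_integral_unique[OF has_integral_combine[OF _ _ l1 l2] g(4)] t by simp
    moreover have "?d ?z \<le> l2"
      using riemannian_dist_le[OF joined_by_length_subpath[OF X g(1) l2]] t g(3) by simp
    moreover have "norm (frame_coeffs X x (?z - \<gamma> 0)) \<le> (1 + e) * l1"
    proof (rule length_ge_frame_norm[OF X g(1) l1])
      show "norm (frame_coeffs X x v) \<le> (1 + e) * norm (frame_coeffs X (\<gamma> s) v)"
        if "0 \<le> s" "s \<le> t" for s v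
        by (rule r1(2)) (use t(4)[OF that] r in simp)
    qed (use t e in auto)
    then have "norm ?w / (1 + e) \<le> l1"
      using e ends by (simp add: pos_divide_le_eq mult.commute)
    ultimately have "norm ?w / (1 + e) - e * r \<le> ?d x - ?d ?z"
      using L by linarith
    moreover have z: "norm (?z - x) = r"
      using t(3) by (simp add: dist_norm)
    moreover from this have "\<bar>?d ?z - ?d x - D (?z - x)\<bar> \<le> e * r"
      using r2(2)[of ?z] r(4) by simp
    moreover have "\<bar>D (?z - x)\<bar> \<le> norm ?w * norm ?g"
      using Cauchy_Schwarz_ineq2[of ?w ?g]
      by (simp only: derivative_frame_coeffs[OF X has_derivative_linear[OF D], of "?z - x" x])
    ultimately have "norm ?w / (1 + e) \<le> norm ?w * norm ?g + 2 * (e * r)"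
      by linarith
    moreover have "e * r \<le> e * (?N * norm ?w)"
      using N[of "?z - x"] e unfolding z by (intro mult_left_mono) auto
    ultimately have "norm ?w / (1 + e) \<le> norm ?w * norm ?g + 2 * (e * (?N * norm ?w))"
      by linarith
    then have "norm ?w * (1 / (1 + e) - 2 * e * ?N) \<le> norm ?w * norm ?g"
      by (simp add: algebra_simps)
    moreover have "norm ?w > 0"
      using N[of "?z - x"] r(1) unfolding z by auto
    ultimately show ?thesis
      by (simp add: mult_le_cancel_left_pos)
  qed
  then have "\<forall>\<^sub>F e in at_right (0::real). 1 / (1 + e) - 2 * e * ?N \<le> norm ?g"
    by (auto simp: eventually_at_right[of 0 1] intro!: exI[of _ 1])
  moreover have "((\<lambda>e. 1 / (1 + e) - 2 * e * ?N) \<longlongrightarrow> 1 / (1 + 0) - 2 * 0 * ?N) (at_right (0::real))"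
    by (intro tendsto_intros) auto
  ultimately show ?thesis
    using tendsto_upperbound[of "\<lambda>e. 1 / (1 + e) - 2 * e * ?N" "1 / (1 + 0) - 2 * 0 * ?N" "at_right 0" "norm ?g"] by simp
qed

text \<open>The upper bound is \<open>dist_derivative_le\<close> in the gradient direction: for the
  vector \<open>?w\<close> with frame coefficients \<open>?g\<close>, the derivative is
  \<open>?g \<bullet> ?g\<close>.\<close>

lemma eikonal:
  assumes X: "smooth_frame X" and xy: "x \<noteq> y"
    and D: "((\<lambda>x'. riemannian_dist X x' y) has_derivative D) (at x)"
  shows "norm (\<chi> i. D (X i x)) = 1"
proof (rule antisym)
  let ?g = "\<chi> i. D (X i x)"
  let ?w = "\<Sum>i\<in>UNIV. ?g $ i *\<^sub>R X i x"
  have "frame_coeffs X x ?w = ?g"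
    by (rule frame_coeffs_eqI[OF X refl])
  then have "?g \<bullet> ?g \<le> norm ?g"
    using dist_derivative_le[OF X D, of ?w]
    by (simp only: derivative_frame_coeffs[OF X has_derivative_linear[OF D], of ?w x])
  then have "norm ?g * norm ?g \<le> norm ?g * 1"
    by (simp add: dot_square_norm power2_eq_square)
  then show "norm ?g \<le> 1"
    by (cases "norm ?g = 0") (auto simp only: mult_le_cancel_left norm_ge_zero)
  show "1 \<le> norm ?g"
    by (rule dist_gradient_ge_1[OF X xy D])
qed

section \<open>The eikonal equation in both variables\<close>

lemma sum_UNIV_Plus:
  fixes f :: "'m::finite + 'n::finite \<Rightarrow> 'a::comm_monoid_add"
  shows "(\<Sum>k\<in>UNIV. f k) = (\<Sum>i\<in>UNIV. f (Inl i)) + (\<Sum>i\<in>UNIV. f (Inr i))"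
  using sum.Plus[of "UNIV :: 'm set" "UNIV :: 'n set" f] by simp

text \<open>Each half of the gradient is the gradient of a partial function of the distance.
  Symmetry of the distance brings the second variable into the position of the first.\<close>

lemma doubled_eikonal:
  fixes X :: "'n::finite \<Rightarrow> real^'n \<Rightarrow> real^'n"
  assumes X: "smooth_frame X" and xy: "x \<noteq> y"
    and u: "(\<lambda>(x, y). riemannian_dist X x y) differentiable (at (x, y))" (is "?u differentiable _")
  shows "norm (\<chi> i. vf_apply (doubled_frame X (Inl i)) ?u (x, y)) = 1"
    and "norm (\<chi> i. vf_apply (doubled_frame X (Inr i)) ?u (x, y)) = 1"
proof -
  let ?D = "frechet_derivative ?u (at (x, y))"
  have D: "(?u has_derivative ?D) (at (x, y))"
    using u frechet_derivative_works by blast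
  have "((\<lambda>x'. (x', y)) has_derivative (\<lambda>h. (h, 0))) (at x)"
    by (auto intro!: derivative_eq_intros)
  from diff_chain_at[OF this D]
  have 1: "((\<lambda>x'. riemannian_dist X x' y) has_derivative (\<lambda>h. ?D (h, 0))) (at x)"
    by (simp add: o_def)
  have "((\<lambda>y'. (x, y')) has_derivative (\<lambda>h. (0, h))) (at y)"
    by (auto intro!: derivative_eq_intros)
  from diff_chain_at[OF this D]
  have 2: "((\<lambda>y'. riemannian_dist X y' x) has_derivative (\<lambda>h. ?D (0, h))) (at y)"
    by (simp add: o_def riemannian_dist_sym[OF X, of x])
  show "norm (\<chi> i. vf_apply (doubled_frame X (Inl i)) ?u (x, y)) = 1"
    using eikonal[OF X xy 1] by (simp add: vf_apply_def doubled_frame_def)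
  show "norm (\<chi> i. vf_apply (doubled_frame X (Inr i)) ?u (x, y)) = 1"
    using eikonal[OF X xy[symmetric] 2] by (simp add: vf_apply_def doubled_frame_def)
qed

section \<open>Uniform bounds for first derivatives and bracket terms\<close>

lemma dist_derivative_le_frame_norm:
  fixes X :: "'n::finite \<Rightarrow> real^'n \<Rightarrow> real^'n"
  assumes X: "smooth_frame X" and xy: "x \<noteq> y"
    and u: "(\<lambda>(x, y). riemannian_dist X x y) differentiable (at (x, y))" (is "?u differentiable _")
  shows "\<bar>frechet_derivative ?u (at (x, y)) w\<bar> \<le>
    norm (frame_coeffs X x (fst w)) + norm (frame_coeffs X y (snd w))"
proof -
  let ?D = "frechet_derivative ?u (at (x, y))"
  have lin: "linear ?D"
    by (rule linear_frechet_derivative[OF u])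
  have "linear (\<lambda>h::real^'n. (h, 0::real^'n))" "linear (\<lambda>h::real^'n. (0::real^'n, h))"
    by (auto intro!: linearI)
  then have lin1: "linear (\<lambda>h. ?D (h, 0))" and lin2: "linear (\<lambda>h. ?D (0, h))"
    using linear_compose[OF _ lin] by (auto simp: o_def)
  \<comment> \<open>Since both halves of the gradient are unit vectors, Cauchy-Schwarz gives a bound
    by frame norms alone, in which the distance function no longer appears.\<close>
  have "norm (\<chi> i. ?D (X i x, 0)) = 1" "norm (\<chi> i. ?D (0, X i y)) = 1"
    using doubled_eikonal[OF X xy u] by (simp_all add: vf_apply_def doubled_frame_def)
  then have "\<bar>?D (fst w, 0)\<bar> \<le> norm (frame_coeffs X x (fst w))"
      "\<bar>?D (0, snd w)\<bar> \<le> norm (frame_coeffs X y (snd w))"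
    using Cauchy_Schwarz_ineq2[of "frame_coeffs X x (fst w)" "\<chi> i. ?D (X i x, 0)"]
      Cauchy_Schwarz_ineq2[of "frame_coeffs X y (snd w)" "\<chi> i. ?D (0, X i y)"]
    unfolding derivative_frame_coeffs[OF X lin1, of "fst w" x, symmetric]
      derivative_frame_coeffs[OF X lin2, of "snd w" y, symmetric] by simp_all
  moreover have "?D w = ?D (fst w, 0) + ?D (0, snd w)"
    using linear_add[OF lin, of "(fst w, 0)" "(0, snd w)"] by simp
  ultimately show ?thesis by linarith
qed

lemma doubled_frame_has_derivative:
  assumes X: "smooth_frame X"
  shows "(doubled_frame X (Inl i) has_derivative (\<lambda>h. (frechet_derivative (X i) (at (fst p)) (fst h), 0))) (at p)"
    and "(doubled_frame X (Inr i) has_derivative (\<lambda>h. (0, frechet_derivative (X i) (at (snd p)) (snd h)))) (at p)"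
proof -
  have D: "(X i has_derivative frechet_derivative (X i) (at x)) (at x)" for x
    using smooth_on_differentiable[of UNIV "X i" x] X frechet_derivative_works
    by (auto simp: smooth_frame_def)
  have fst: "(fst has_derivative fst) (at p)" and snd: "(snd has_derivative snd) (at p)"
    by (auto intro: bounded_linear_imp_has_derivative bounded_linear_fst bounded_linear_snd)
  show "(doubled_frame X (Inl i) has_derivative (\<lambda>h. (frechet_derivative (X i) (at (fst p)) (fst h), 0))) (at p)"
    using has_derivative_Pair[OF diff_chain_at[OF fst D] has_derivative_const]
    by (simp add: doubled_frame_def[abs_def] o_def)
  show "(doubled_frame X (Inr i) has_derivative (\<lambda>h. (0, frechet_derivative (X i) (at (snd p)) (snd h)))) (at p)"
    using has_derivative_Pair[OF has_derivative_const diff_chain_at[OF snd D]]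
    by (simp add: doubled_frame_def[abs_def] o_def)
qed

text \<open>Smoothness gives continuity of the derivative only in a fixed direction. Expanding the
  moving direction in the standard basis reduces the claim to finitely many fixed ones.\<close>

lemma continuous_on_frechet_derivative_apply:
  assumes f: "smooth_on UNIV f" and "continuous_on S g" "continuous_on S v"
  shows "continuous_on S (\<lambda>p. frechet_derivative f (at (g p)) (v p))"
proof -
  have "continuous_on S (\<lambda>p. frechet_derivative f (at (g p)) b)" for b
    by (rule continuous_on_compose2[OF smooth_on_continuous_on[OF smooth_on_frechet[OF f]] assms(2)]) simp
  then have "continuous_on S (\<lambda>p. \<Sum>b\<in>Basis. (v p \<bullet> b) *\<^sub>R frechet_derivative f (at (g p)) b)"
    by (intro continuous_intros assms)
  then show ?thesis
    by (subst linear_sum_Basis[OF linear_frechet_derivative[OF smooth_on_differentiable[OF f UNIV_I]]])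
qed

lemma doubled_frame_differentiable:
  assumes "smooth_frame X"
  shows "doubled_frame X k differentiable (at p)"
  using doubled_frame_has_derivative[OF assms, THEN differentiableI] by (cases k) simp_all

lemma continuous_on_doubled_frame:
  assumes "smooth_frame X"
  shows "continuous_on UNIV (doubled_frame X k)"
  by (simp add: continuous_on_eq_continuous_at differentiable_imp_continuous_within
      doubled_frame_differentiable[OF assms])

lemma continuous_on_doubled_frame_derivative:
  fixes X :: "'n::finite \<Rightarrow> real^'n \<Rightarrow> real^'n"
  assumes X: "smooth_frame X"
  shows "continuous_on UNIV (\<lambda>p. frechet_derivative (doubled_frame X k) (at p) (doubled_frame X l p))"
proof -
  have f: "smooth_on UNIV (X i)" for i using X by (simp add: smooth_frame_def)
  show ?thesis
    using doubled_frame_has_derivative[OF X, THEN frechet_derivative_at, symmetric]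
    by (cases k) (auto intro!: continuous_intros continuous_on_frechet_derivative_apply[OF f] continuous_on_doubled_frame[OF X])
qed

text \<open>These frame norms are continuous on the compact set \<open>K \<times> K\<close>. A bound
  for the sum of the nonnegative functions over all index pairs serves every pair at once. Together
  with \<open>dist_derivative_le_frame_norm\<close> it controls the bracket terms at all admissible
  points.\<close>

lemma frame_norm_bracket_bounded:
  fixes X :: "'n::finite \<Rightarrow> real^'n \<Rightarrow> real^'n"
  assumes X: "smooth_frame X" and K: "compact K"
  obtains M where "M \<ge> 0" "\<And>k l x y. x \<in> K \<Longrightarrow> y \<in> K \<Longrightarrow>
    norm (frame_coeffs X x (fst (frechet_derivative (doubled_frame X k) (at (x, y)) (doubled_frame X l (x, y))))) +
    norm (frame_coeffs X y (snd (frechet_derivative (doubled_frame X k) (at (x, y)) (doubled_frame X l (x, y))))) \<le> M"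
proof -
  define B where "B k l p = frechet_derivative (doubled_frame X k) (at p) (doubled_frame X l p)" for k l p
  define G where "G k l p = norm (frame_coeffs X (fst p) (fst (B k l p))) + norm (frame_coeffs X (snd p) (snd (B k l p)))" for k l p
  have B: "(B k l \<longlongrightarrow> B k l p) (at p within S)" for k l p S
  proof -
    have "isCont (B k l) p"
      using continuous_on_doubled_frame_derivative[OF X, of k l]
      by (simp only: B_def[symmetric] continuous_on_eq_continuous_at open_UNIV UNIV_I simp_thms ball_UNIV)
    then show ?thesis
      unfolding isCont_def by (rule tendsto_mono[OF at_le[OF subset_UNIV]])
  qed
  have "continuous_on (K \<times> K) (G k l)" for k l
    unfolding continuous_on_def G_def
    by (intro ballI tendsto_intros tendsto_frame_coeffs[OF X] B)
  then have "continuous_on (K \<times> K) (\<lambda>p. \<Sum>k\<in>UNIV. \<Sum>l\<in>UNIV. G k l p)"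
    by (intro continuous_intros)
  then have "bounded ((\<lambda>p. \<Sum>k\<in>UNIV. \<Sum>l\<in>UNIV. G k l p) ` (K \<times> K))"
    by (intro compact_imp_bounded compact_continuous_image compact_Times K)
  then obtain M where M: "M > 0" "\<And>p. p \<in> K \<times> K \<Longrightarrow> norm (\<Sum>k\<in>UNIV. \<Sum>l\<in>UNIV. G k l p) \<le> M"
    unfolding bounded_pos by blast
  have "G k l p \<le> M" if "p \<in> K \<times> K" for k l p
  proof -
    have pos: "0 \<le> G k l p" for k l by (simp add: G_def)
    have "G k l p \<le> (\<Sum>l\<in>UNIV. G k l p)"
      by (rule member_le_sum) (auto simp: pos)
    also have "\<dots> \<le> (\<Sum>k\<in>UNIV. \<Sum>l\<in>UNIV. G k l p)"
      by (rule member_le_sum) (auto simp: pos intro: sum_nonneg)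
    also have "\<dots> \<le> M" using M(2)[OF that] by simp
    finally show ?thesis .
  qed
  then show ?thesis
    using M(1) that[of M] unfolding G_def B_def by force
qed

section \<open>The quadratic form as a squared norm, and its bound\<close>

lemma inner_symmetric_square:
  fixes A :: "real^'m^'m"
  assumes "transpose A = A"
  shows "((A ** A) *v v) \<bullet> v = (A *v v) \<bullet> (A *v v)"
  using dot_lmul_matrix[of "A *v v" A v]
  by (simp only: matrix_vector_mul_assoc[symmetric] transpose_matrix_vector[symmetric] assms)

lemma transpose_sym_part: "transpose (sym_part A) = sym_part A"
  by (simp add: sym_part_def transpose_def vec_eq_iff add.commute)

theorem lemma3p5:
  fixes X :: "'n::finite \<Rightarrow> real^'n \<Rightarrow> real^'n" and K :: "(real^'n) set"
  assumes "smooth_frame X" and "compact K"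
  shows "let d = (\<lambda>(x, y). riemannian_dist X x y); Z = doubled_frame X in
    \<exists>C. \<forall>x\<in>K. \<forall>y\<in>K. x \<noteq> y \<longrightarrow> (\<exists>U. open U \<and> (x, y) \<in> U \<and> smooth_on U d) \<longrightarrow>
      (let A = sym_part (frame_hess Z d (x, y)); v = frame_grad Z d (x, y)
       in 0 \<le> ((A ** A) *v v) \<bullet> v \<and> ((A ** A) *v v) \<bullet> v \<le> C)"
proof -
  note X = assms(1)
  define d where "d = (\<lambda>(x, y). riemannian_dist X x y)"
  define Z where "Z = doubled_frame X"
  let ?B = "\<lambda>k l p. frechet_derivative (Z k) (at p) (Z l p)"
  obtain M where M: "M \<ge> 0" "\<And>k l x y. x \<in> K \<Longrightarrow> y \<in> K \<Longrightarrow>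
      norm (frame_coeffs X x (fst (?B k l (x, y)))) + norm (frame_coeffs X y (snd (?B k l (x, y)))) \<le> M"
    by (rule frame_norm_bracket_bounded[OF assms, folded Z_def]) (rule that)
  \<comment> \<open>Bounds one component of \<open>A *v v\<close>: each bracket term is a difference
    of two numbers of modulus at most \<open>M\<close>, gradient components have modulus at most 1,
    and the division by 2 comes from the symmetric part.\<close>
  define R where "R = (\<Sum>l\<in>(UNIV :: ('n + 'n) set). 2 * M) / 2"
  have "(A *v v) \<bullet> (A *v v) \<le> (\<Sum>k\<in>(UNIV :: ('n + 'n) set). R * R)"
    if x: "x \<in> K" and y: "y \<in> K" and xy: "x \<noteq> y" and U: "open U" "(x, y) \<in> U" "smooth_on U d"
      and A: "A = sym_part (frame_hess Z d (x, y))" and v: "v = frame_grad Z d (x, y)" for x y U A v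
  proof -
    let ?p = "(x, y)"
    \<comment> \<open>The diagonal is removed because the eikonal equation holds only at distinct
      points; the remaining set is still an open neighbourhood of \<open>?p\<close>.\<close>
    let ?W = "U \<inter> {p. fst p \<noteq> snd p}"
    have W: "open ?W" "?p \<in> ?W"
      using U xy by (auto intro!: open_Int open_Collect_neq continuous_intros)
    have dW: "smooth_on ?W d"
      using U(3) smooth_on_subset by blast
    have du: "d differentiable (at q)" if "q \<in> U" for q
      using smooth_on_differentiable[OF U(3) that] .
    have dZ: "Z k differentiable (at ?p)" for k
      unfolding Z_def by (rule doubled_frame_differentiable[OF X])
    \<comment> \<open>The value 2 is the sum of one unit squared norm from each variable.\<close>
    have const: "(\<Sum>l\<in>UNIV. (vf_apply (Z l) d q)\<^sup>2) = 2" if "q \<in> ?W" for q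
    proof -
      obtain a b where q: "q = (a, b)" by fastforce
      have "norm (\<chi> i. vf_apply (Z (Inl i)) d q) = 1" "norm (\<chi> i. vf_apply (Z (Inr i)) d q) = 1"
        using doubled_eikonal[OF X, of a b] du[of q] that unfolding q d_def Z_def by auto
      then show ?thesis
        by (simp add: sum_UNIV_Plus norm_eq_1 inner_vec_def power2_eq_square)
    qed
    have D: "\<bar>frechet_derivative d (at ?p) (?B k l ?p)\<bar> \<le> M" for k l
      using dist_derivative_le_frame_norm[OF X xy du[OF U(2), unfolded d_def], of "?B k l ?p"] M(2)[OF x y, of k l]
      unfolding d_def by linarith
    have v1: "\<bar>v $ l\<bar> \<le> 1" for l
    proof (cases l)
      case (Inl i)
      then show ?thesis
        using component_le_norm_cart[of "\<chi> i. vf_apply (Z (Inl i)) d ?p" i]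
          doubled_eikonal(1)[OF X xy du[OF U(2), unfolded d_def]]
        by (simp add: v frame_grad_def d_def Z_def)
    next
      case (Inr i)
      then show ?thesis
        using component_le_norm_cart[of "\<chi> i. vf_apply (Z (Inr i)) d ?p" i]
          doubled_eikonal(2)[OF X xy du[OF U(2), unfolded d_def]]
        by (simp add: v frame_grad_def d_def Z_def)
    qed
    have comp: "\<bar>(A *v v) $ k\<bar> \<le> R" for k
    proof -
      let ?b = "\<lambda>l. frechet_derivative d (at ?p) (?B k l ?p) - frechet_derivative d (at ?p) (?B l k ?p)"
      have "\<bar>(\<Sum>l\<in>UNIV. ?b l * v $ l)\<bar> \<le> (\<Sum>l\<in>UNIV. \<bar>?b l * v $ l\<bar>)"
        by (rule sum_abs)
      also have "\<dots> \<le> (\<Sum>l\<in>(UNIV :: ('n + 'n) set). 2 * M)"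
      proof (rule sum_mono)
        fix l
        have "\<bar>?b l\<bar> \<le> 2 * M" using D[of k l] D[of l k] by linarith
        then have "\<bar>?b l\<bar> * \<bar>v $ l\<bar> \<le> (2 * M) * 1"
          using v1 M(1) by (intro mult_mono) auto
        then show "\<bar>?b l * v $ l\<bar> \<le> 2 * M" by (simp add: abs_mult)
      qed
      finally have "\<bar>(\<Sum>l\<in>UNIV. ?b l * v $ l) / 2\<bar> \<le> R"
        unfolding R_def abs_divide by (simp del: sum_constant)
      moreover have "(A *v v) $ k = (\<Sum>l\<in>UNIV. ?b l * v $ l) / 2"
        unfolding A v by (rule sym_hess_grad_eq_brackets[OF W dW dZ const])
      ultimately show ?thesis by simp
    qed
    have "(A *v v) $ k * (A *v v) $ k \<le> R * R" for k
      using mult_mono[OF comp[of k] comp[of k] order_trans[OF abs_ge_zero comp[of k]] abs_ge_zero] by simp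
    then show ?thesis
      unfolding inner_vec_def by (intro sum_mono) simp
  qed
  then show ?thesis
    unfolding Let_def d_def[symmetric] Z_def[symmetric]
    unfolding inner_symmetric_square[OF transpose_sym_part]
    by (intro exI[of _ "\<Sum>k\<in>(UNIV :: ('n + 'n) set). R * R"]) (blast intro: inner_ge_zero)
qed

end
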